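(* For any set $\mathcal{D} \subseteq \{d \in \mathbb{R}^n \mid Q + \mathrm{diag}(d) \succeq 0\}$, one has $\mu_{BW} \geq \mu_{\mathcal{D}}$.
   Context: Let $Q$ be a real symmetric indefinite $n\times n$ matrix and $q \in \mathbb{R}^n$. For each $i\in\{1,\dots,n\}$ let $S_i \subseteq \mathbb{R}$ be a nonempty closed and bounded (not necessarily convex) set, and put $L_i := \min\{x \mid x\in S_i\}$, $R_i := \max\{x \mid x \in S_i\}$. Let $\ell_i : [L_i,R_i]\to\mathbb{R}$ be the largest convex function on $[L_i,R_i]$ such that $\ell_i(x)\le x^2$ for all $x\in S_i$, and let $u_i:[L_i,R_i]\to\mathbb{R}$ be the smallest concave function on $[L_i,R_i]$ such that $u_i(x)\ge x^2$ for all $x\in S_i$. For $d\in\mathbb{R}^n$, $\mathrm{diag}(d)$ is the diagonal matrix with diagonal $d$; $\succeq 0$ means positive semidefinite; $\langle A,B\rangle = \mathrm{trace}(A^T B)$. For a set $\mathcal{D}\subseteq\{d\in\mathbb{R}^n \mid Q+\mathrm{diag}(d)\succeq 0\}$, $\mu_{\mathcal{D}}$ denotes the optimal value (infimum, in the extended reals) of the problem $$\min_{v\in\mathbb{R},\,x\in\mathbb{R}^n}\ v+q^Tx \quad \text{s.t.}\quad v \ge x^TQx + \sum_{i:\,d_i<0} d_i\,(x_i^2-\ell_i(x_i)) + \sum_{i:\,d_i>0} d_i\,(x_i^2-u_i(x_i))\ \ \forall d\in\mathcal{D},\qquad L_i\le x_i\le R_i,\ i=1,\dots,n.$$ $\mu_{BW}$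 denotes the optimal value of the semidefinite relaxation $$\min_{x\in\mathbb{R}^n,\,X}\ \langle Q,X\rangle + q^Tx\quad\text{s.t.}\quad \ell_i(x_i)\le X_{ii}\le u_i(x_i),\ i=1,\dots,n,\qquad \begin{bmatrix}1 & x^T\\ x & X\end{bmatrix}\succeq 0,$$ where $X$ ranges over real symmetric $n\times n$ matrices, and the constraints $\ell_i(x_i)\le X_{ii}\le u_i(x_i)$ implicitly require $x_i\in[L_i,R_i]$. *)

theory Defs
  imports "HOL-Analysis.Analysis"
begin

section \<open>Matrices\<close>

definition psd :: "real^'n^'n \<Rightarrow> bool" where
  "psd A \<longleftrightarrow> transpose A = A \<and> (\<forall>x. 0 \<le> x \<bullet> (A *v x))"

definition indefinite :: "real^'n^'n \<Rightarrow> bool" where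
  "indefinite A \<longleftrightarrow> (\<exists>x. x \<bullet> (A *v x) > 0) \<and> (\<exists>x. x \<bullet> (A *v x) < 0)"

definition diag_mat :: "real^'n \<Rightarrow> real^'n^'n" where
  "diag_mat d = (\<chi> i j. if i = j then d $ i else 0)"

definition mat_inner :: "real^'n^'n \<Rightarrow> real^'n^'n \<Rightarrow> real" where
  "mat_inner A B = trace (transpose A ** B)"

text \<open>The matrix with block rows (1, \<open>x\<close> transposed) and (\<open>x\<close>, \<open>X\<close>): the index \<open>None\<close> stands for
  the additional first row and column.\<close>

definition bordered :: "real^'n \<Rightarrow> real^'n^'n \<Rightarrow> real^('n option)^('n option)" where
  "bordered x X = (\<chi> i j. case (i, j) of
       (None, None) \<Rightarrow> 1
     | (None, Some k) \<Rightarrow> x $ k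
     | (Some k, None) \<Rightarrow> x $ k
     | (Some k, Some m) \<Rightarrow> X $ k $ m)"

section \<open>Envelopes of the square function over a compact set of reals\<close>

definition lo :: "real set \<Rightarrow> real" where
  "lo S = (LEAST x. x \<in> S)"

definition hi :: "real set \<Rightarrow> real" where
  "hi S = (GREATEST x. x \<in> S)"

text \<open>Both predicates only constrain the function on the interval from \<open>lo S\<close> to \<open>hi S\<close>; its values
  elsewhere are arbitrary and must not be used.\<close>

definition largest_convex_below_square :: "real set \<Rightarrow> (real \<Rightarrow> real) \<Rightarrow> bool" where
  "largest_convex_below_square S l \<longleftrightarrow>
     convex_on {lo S..hi S} l \<and> (\<forall>x\<in>S. l x \<le> x\<^sup>2) \<and>
     (\<forall>g. convex_on {lo S..hi S} g \<and> (\<forall>x\<in>S. g x \<le> x\<^sup>2) \<longrightarrow> (\<forall>x\<in>{lo S..hi S}. g x \<le> l x))"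

definition smallest_concave_above_square :: "real set \<Rightarrow> (real \<Rightarrow> real) \<Rightarrow> bool" where
  "smallest_concave_above_square S u \<longleftrightarrow>
     concave_on {lo S..hi S} u \<and> (\<forall>x\<in>S. u x \<ge> x\<^sup>2) \<and>
     (\<forall>g. concave_on {lo S..hi S} g \<and> (\<forall>x\<in>S. g x \<ge> x\<^sup>2) \<longrightarrow> (\<forall>x\<in>{lo S..hi S}. g x \<ge> u x))"

lemma lo_hi_compact:
  assumes "S \<noteq> {}" "compact S"
  shows "lo S \<in> S" "hi S \<in> S" "S \<subseteq> {lo S..hi S}"
proof -
  obtain a where a: "a \<in> S" "\<forall>x\<in>S. a \<le> x"
    using compact_attains_inf[OF assms(2,1)] by blast
  obtain b where b: "b \<in> S" "\<forall>x\<in>S. x \<le> b"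
    using compact_attains_sup[OF assms(2,1)] by blast
  have "lo S = a" unfolding lo_def by (rule Least_equality) (use a in auto)
  moreover have "hi S = b" unfolding hi_def by (rule Greatest_equality) (use b in auto)
  ultimately show "lo S \<in> S" "hi S \<in> S" "S \<subseteq> {lo S..hi S}"
    using a b by auto
qed

lemma largest_convex_minorant_exists:
  fixes f :: "real \<Rightarrow> real"
  assumes "a \<in> S" "b \<in> S" "S \<subseteq> {a..b}" and nn: "bdd_below (f ` S)"
  shows "\<exists>l. convex_on {a..b} l \<and> (\<forall>x\<in>S. l x \<le> f x) \<and>
     (\<forall>g. convex_on {a..b} g \<and> (\<forall>x\<in>S. g x \<le> f x) \<longrightarrow> (\<forall>x\<in>{a..b}. g x \<le> l x))"
proof -
  define A where "A = {g. convex_on {a..b} g \<and> (\<forall>x\<in>S. g x \<le> f x)}"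
  define l where "l x = (SUP g\<in>A. g x)" for x
  obtain m where m: "\<forall>x\<in>S. m \<le> f x" using nn by (auto simp: bdd_below_def)
  have "(\<lambda>_. m) \<in> A" using m unfolding A_def
    by (auto simp: convex_on_def simp flip: distrib_right)
  hence ne: "A \<noteq> {}" by auto
  have bd: "bdd_above ((\<lambda>g. g x) ` A)" if x: "x \<in> {a..b}" for x
  proof (rule bdd_aboveI2)
    fix g assume g: "g \<in> A"
    have "x \<in> closed_segment a b" using x by (simp add: closed_segment_eq_real_ivl)
    then obtain t where t: "0 \<le> t" "t \<le> 1" "x = (1 - t) *\<^sub>R a + t *\<^sub>R b"
      by (auto simp: in_segment)
    have "convex_on {a..b} g" "g a \<le> f a" "g b \<le> f b" using g assms unfolding A_def by auto
    have ab: "a \<in> {a..b}" "b \<in> {a..b}" using assms by auto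
    have "g x \<le> (1 - t) * g a + t * g b"
      unfolding t(3) using \<open>convex_on {a..b} g\<close> t(1,2) ab
      unfolding convex_on_def by simp
    also have "\<dots> \<le> (1 - t) * f a + t * f b"
      using t \<open>g a \<le> f a\<close> \<open>g b \<le> f b\<close> by (intro add_mono mult_left_mono) auto
    also have "\<dots> \<le> (1 - t) * max (f a) (f b) + t * max (f a) (f b)"
      using t by (intro add_mono mult_left_mono) auto
    finally show "g x \<le> max (f a) (f b)" by (simp add: algebra_simps)
  qed
  have up: "g x \<le> l x" if "g \<in> A" "x \<in> {a..b}" for g x
    unfolding l_def by (rule cSUP_upper[OF that(1) bd[OF that(2)]])
  have "convex_on {a..b} l"
    unfolding convex_on_def
  proof (intro conjI ballI allI impI)
    fix x y u v :: real
    assume *: "x \<in> {a..b}" "y \<in> {a..b}" "0 \<le> u" "0 \<le> v" "u + v = 1"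
    show "l (u *\<^sub>R x + v *\<^sub>R y) \<le> u * l x + v * l y"
      unfolding l_def[of "u *\<^sub>R x + v *\<^sub>R y"]
    proof (rule cSUP_least[OF ne])
      fix g assume g: "g \<in> A"
      hence "g (u *\<^sub>R x + v *\<^sub>R y) \<le> u * g x + v * g y"
        using * unfolding A_def convex_on_def by blast
      also have "\<dots> \<le> u * l x + v * l y"
        using * up[OF g] by (intro add_mono mult_left_mono) auto
      finally show "g (u *\<^sub>R x + v *\<^sub>R y) \<le> u * l x + v * l y" .
    qed
  qed simp
  moreover have "l x \<le> f x" if "x \<in> S" for x
    unfolding l_def by (rule cSUP_least[OF ne]) (use that in \<open>auto simp: A_def\<close>)
  ultimately show ?thesis
    using up unfolding A_def by blast
qed

lemma largest_convex_below_square_exists: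
  assumes "S \<noteq> {}" "compact S"
  shows "\<exists>l. largest_convex_below_square S l"
  unfolding largest_convex_below_square_def
  by (rule largest_convex_minorant_exists[OF lo_hi_compact[OF assms]])
     (auto intro!: bdd_belowI2[where m = 0])

lemma smallest_concave_above_square_exists:
  assumes "S \<noteq> {}" "compact S"
  shows "\<exists>u. smallest_concave_above_square S u"
proof -
  have "compact ((\<lambda>x. - x\<^sup>2) ` S)"
    by (intro compact_continuous_image continuous_intros assms)
  hence "bdd_below ((\<lambda>x. - x\<^sup>2) ` S)"
    by (intro bounded_imp_bdd_below compact_imp_bounded)
  from largest_convex_minorant_exists[OF lo_hi_compact[OF assms] this]
  obtain l where l: "convex_on {lo S..hi S} l" "\<forall>x\<in>S. l x \<le> - x\<^sup>2"
    "\<And>g. convex_on {lo S..hi S} g \<Longrightarrow> \<forall>x\<in>S. g x \<le> - x\<^sup>2 \<Longrightarrow> \<forall>x\<in>{lo S..hi S}. g x \<le> l x"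
    by blast
  have "smallest_concave_above_square S (\<lambda>x. - l x)"
    unfolding smallest_concave_above_square_def concave_on_def
  proof (intro conjI allI impI ballI)
    show "convex_on {lo S..hi S} (\<lambda>x. - (- l x))" using l(1) by simp
    show "x\<^sup>2 \<le> - l x" if "x \<in> S" for x using l(2) that by fastforce
    fix g x
    assume "convex_on {lo S..hi S} (\<lambda>x. - g x) \<and> (\<forall>x\<in>S. x\<^sup>2 \<le> g x)" "x \<in> {lo S..hi S}"
    thus "- l x \<le> g x" using l(3)[of "\<lambda>x. - g x"] by force
  qed
  thus ?thesis by blast
qed

section \<open>The two relaxations\<close>

text \<open>Optimal values are infima in the extended reals, so an infeasible problem has value
  \<open>\<infinity>\<close> and an unbounded one \<open>-\<infinity>\<close>.\<close>

definition mu_D ::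
  "real^'n^'n \<Rightarrow> real^'n \<Rightarrow> ('n \<Rightarrow> real set) \<Rightarrow> ('n \<Rightarrow> real \<Rightarrow> real) \<Rightarrow> ('n \<Rightarrow> real \<Rightarrow> real)
    \<Rightarrow> (real^'n) set \<Rightarrow> ereal" where
  "mu_D Q q S l u D = Inf {ereal (v + q \<bullet> x) | v x.
     (\<forall>d\<in>D. v \<ge> x \<bullet> (Q *v x)
        + (\<Sum>i | d $ i < 0. d $ i * ((x $ i)\<^sup>2 - l i (x $ i)))
        + (\<Sum>i | d $ i > 0. d $ i * ((x $ i)\<^sup>2 - u i (x $ i)))) \<and>
     (\<forall>i. lo (S i) \<le> x $ i \<and> x $ i \<le> hi (S i))}"

definition mu_BW ::
  "real^'n^'n \<Rightarrow> real^'n \<Rightarrow> ('n \<Rightarrow> real set) \<Rightarrow> ('n \<Rightarrow> real \<Rightarrow> real) \<Rightarrow> ('n \<Rightarrow> real \<Rightarrow> real)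
    \<Rightarrow> ereal" where
  "mu_BW Q q S l u = Inf {ereal (mat_inner Q X + q \<bullet> x) | x X.
     transpose X = X \<and>
     (\<forall>i. lo (S i) \<le> x $ i \<and> x $ i \<le> hi (S i)) \<and>
     (\<forall>i. l i (x $ i) \<le> X $ i $ i \<and> X $ i $ i \<le> u i (x $ i)) \<and>
     psd (bordered x X)}"

end

theory Submission
  imports Defs
begin

text \<open>
  Every point \<open>(x, X)\<close> of the semidefinite relaxation yields the point \<open>(v, x)\<close> with
  \<open>v = mat_inner Q X\<close>, of the same objective value, for the other problem. To see that
  it is feasible, let \<open>Y = X - outer x\<close>, which is the Schur complement of the entry \<open>1\<close> in the
  bordered matrix and hence positive semidefinite. For \<open>d \<in> D\<close> the pairing of the positive
  semidefinite matrices \<open>Q + diag_mat d\<close> and \<open>Y\<close> is nonnegative, which reads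
  \<open>mat_inner Q X \<ge> x \<bullet> (Q *v x) + (\<Sum>i. d\<^sub>i * (x\<^sub>i\<^sup>2 - X\<^sub>i\<^sub>i))\<close>. According to the sign of \<open>d\<^sub>i\<close>, replacing
  \<open>X\<^sub>i\<^sub>i\<close> by its bound \<open>l\<^sub>i (x\<^sub>i)\<close> or \<open>u\<^sub>i (x\<^sub>i)\<close> can only decrease the right-hand side, and this gives
  the constraint belonging to \<open>d\<close>.

  Both facts about positive semidefinite matrices come from one step of symmetric Gaussian
  elimination, \<open>psd_deflate\<close>: eliminating the entry \<open>1\<close> of the bordered matrix leaves \<open>Y\<close>, and
  eliminating all pivots one after the other writes a positive semidefinite matrix as a sum of
  matrices \<open>c *\<^sub>R outer b\<close> with \<open>c \<ge> 0\<close>, whose pairing with \<open>A\<close> is \<open>c * (b \<bullet> (A *v b)) \<ge> 0\<close>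
  (\<open>mat_inner_psd_nonneg\<close>).
\<close>

definition outer :: "real^'n \<Rightarrow> real^'n^'n" where
  "outer b = (\<chi> i j. b $ i * b $ j)"

lemma outer_nth [simp]: "outer b $ i $ j = b $ i * b $ j"
  by (simp add: outer_def)

lemma outer_mult_vec: "outer b *v x = (b \<bullet> x) *\<^sub>R b"
  by (simp add: vec_eq_iff matrix_vector_mult_def inner_vec_def sum_distrib_left
      sum_distrib_right mult_ac)

lemma mat_inner_eq_sum: "mat_inner A B = (\<Sum>i\<in>UNIV. \<Sum>j\<in>UNIV. A $ i $ j * B $ i $ j)"
  unfolding mat_inner_def trace_def
  by (simp add: matrix_matrix_mult_def transpose_def) (rule sum.swap)

lemma mat_inner_diff_right: "mat_inner A (B - C) = mat_inner A B - mat_inner A C"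
  by (simp add: mat_inner_eq_sum algebra_simps sum_subtractf)

lemma mat_inner_add_left: "mat_inner (A + B) C = mat_inner A C + mat_inner B C"
  by (simp add: mat_inner_eq_sum algebra_simps sum.distrib)

lemma mat_inner_scaleR_right: "mat_inner A (c *\<^sub>R B) = c * mat_inner A B"
  by (simp add: mat_inner_eq_sum sum_distrib_left mult_ac)

lemma mat_inner_outer: "mat_inner A (outer b) = b \<bullet> (A *v b)"
  by (simp add: mat_inner_eq_sum inner_vec_def matrix_vector_mult_def sum_distrib_left mult_ac)

lemma mat_inner_diag_mat: "mat_inner (diag_mat d) B = (\<Sum>i\<in>UNIV. d $ i * B $ i $ i)"
  by (simp add: mat_inner_eq_sum diag_mat_def if_distrib[of "\<lambda>a. a * _"] cong: if_cong)

lemma psd_sym: "psd B \<Longrightarrow> B $ i $ j = B $ j $ i"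
  unfolding psd_def transpose_def by (metis vec_lambda_beta)

lemma psd_quadratic_axis:
  assumes "psd B"
  shows "0 \<le> x \<bullet> (B *v x) + 2 * t * (B *v x) $ k + t\<^sup>2 * B $ k $ k"
proof -
  let ?e = "axis k 1 :: real^'a"
  have tr: "transpose B = B" and "0 \<le> (x + t *\<^sub>R ?e) \<bullet> (B *v (x + t *\<^sub>R ?e))"
    using assms by (auto simp: psd_def)
  moreover have "x \<bullet> (B *v ?e) = (B *v x) $ k"
    using dot_lmul_matrix[of x B ?e] tr
    by (metis inner_axis inner_real_def mult.right_neutral transpose_matrix_vector)
  moreover have "?e \<bullet> (B *v x) = (B *v x) $ k" "?e \<bullet> (B *v ?e) = B $ k $ k"
    by (simp_all add: inner_axis' matrix_vector_mul_component inner_axis)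
  ultimately show ?thesis
    by (simp add: matrix_vector_right_distrib matrix_vector_mult_scaleR inner_add_left
        inner_add_right power2_eq_square algebra_simps)
qed

text \<open>A quadratic form that vanishes at a basis vector is an affine function of the parameter
  along each line in that direction, and a nonnegative affine function is constant.\<close>

lemma psd_zero_diagonal:
  assumes "psd B" "B $ k $ k = 0"
  shows "B $ i $ k = 0"
proof (rule ccontr)
  assume nz: "B $ i $ k \<noteq> 0"
  have "(B *v axis i 1) $ k = B $ i $ k"
    using psd_sym[OF assms(1)] by (simp add: matrix_vector_mul_component inner_axis)
  then have "0 \<le> axis i 1 \<bullet> (B *v axis i 1) + 2 * t * B $ i $ k" for t
    using psd_quadratic_axis[OF assms(1), of "axis i 1" t k] assms(2) by simp
  \<comment> \<open>this parameter makes the right-hand side \<open>- 1\<close>\<close>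
  from this[of "- (axis i 1 \<bullet> (B *v axis i 1) + 1) / (2 * B $ i $ k)"] nz
  show False by (simp add: field_simps)
qed

text \<open>One step of symmetric Gaussian elimination. For a zero pivot the scalar is
  \<open>1 / 0 = 0\<close> and nothing happens.\<close>

definition deflate :: "real^'n^'n \<Rightarrow> 'n \<Rightarrow> real^'n^'n" where
  "deflate B k = B - (1 / B $ k $ k) *\<^sub>R outer (column k B)"

lemma deflate_nth: "deflate B k $ i $ j = B $ i $ j - B $ i $ k * B $ j $ k / B $ k $ k"
  by (simp add: deflate_def column_def)

text \<open>The form of the deflated matrix at \<open>x\<close> is the minimum of the form of \<open>B\<close> on the line through
  \<open>x\<close> in the direction of the pivot.\<close>

lemma psd_deflate:
  assumes "psd B"
  shows "psd (deflate B k)"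
  unfolding psd_def
proof (intro conjI allI)
  show "transpose (deflate B k) = deflate B k"
    using psd_sym[OF assms] by (simp add: vec_eq_iff transpose_def deflate_nth mult.commute)
  fix x :: "real^'a"
  have "column k B \<bullet> x = (B *v x) $ k"
    using psd_sym[OF assms, of _ k]
    by (simp add: column_def inner_vec_def matrix_vector_mult_def)
  then have "x \<bullet> (deflate B k *v x) = x \<bullet> (B *v x) - ((B *v x) $ k)\<^sup>2 / B $ k $ k"
    by (simp add: deflate_def matrix_vector_mult_diff_rdistrib scaleR_matrix_vector_assoc [symmetric]
        outer_mult_vec inner_diff_right inner_commute[of x "column k B"] power2_eq_square)
  \<comment> \<open>the minimizing parameter on the line\<close>
  also have "\<dots> = x \<bullet> (B *v x) + 2 * (- (B *v x) $ k / B $ k $ k) * (B *v x) $ k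
      + (- (B *v x) $ k / B $ k $ k)\<^sup>2 * B $ k $ k"
    by (cases "B $ k $ k = 0") (simp_all add: power2_eq_square field_simps)
  also have "\<dots> \<ge> 0"
    by (rule psd_quadratic_axis[OF assms])
  finally show "0 \<le> x \<bullet> (deflate B k *v x)" .
qed

text \<open>The induction is on the number of nonzero diagonal entries of \<open>B\<close>: eliminating a pivot clears
  its diagonal entry and, by \<open>psd_zero_diagonal\<close>, creates no new one.\<close>

lemma mat_inner_psd_nonneg:
  assumes "psd A" "psd B"
  shows "0 \<le> mat_inner A B"
  using assms(2)
proof (induction "card {i. B $ i $ i \<noteq> 0}" arbitrary: B rule: less_induct)
  case less
  show ?case
  proof (cases "\<exists>k. B $ k $ k \<noteq> 0")
    case False
    then show ?thesis
      using psd_zero_diagonal[OF less.prems] by (simp add: mat_inner_eq_sum)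
  next
    case True
    then obtain k where k: "B $ k $ k \<noteq> 0" by blast
    have "0 \<le> axis k 1 \<bullet> (B *v axis k 1)"
      using less.prems by (simp add: psd_def)
    then have pos: "0 \<le> B $ k $ k"
      by (simp add: inner_axis' matrix_vector_mul_component inner_axis)
    have "deflate B k $ i $ i = 0" if "B $ i $ i = 0" for i
      using psd_zero_diagonal[OF less.prems that, of k] psd_sym[OF less.prems, of i k] that
      by (simp add: deflate_nth)
    moreover have "deflate B k $ k $ k = 0"
      by (simp add: deflate_nth)
    ultimately have "{i. deflate B k $ i $ i \<noteq> 0} \<subset> {i. B $ i $ i \<noteq> 0}"
      using k by blast
    then have "card {i. deflate B k $ i $ i \<noteq> 0} < card {i. B $ i $ i \<noteq> 0}"
      by (simp add: psubset_card_mono)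
    then have "0 \<le> mat_inner A (deflate B k)"
      using less.hyps psd_deflate[OF less.prems] by blast
    moreover have "0 \<le> column k B \<bullet> (A *v column k B)"
      using assms(1) by (simp add: psd_def)
    ultimately show ?thesis
      using pos by (simp add: deflate_def mat_inner_diff_right mat_inner_scaleR_right
          mat_inner_outer) (meson divide_nonneg_nonneg order_trans)
  qed
qed

lemma sum_UNIV_option:
  fixes f :: "'n::finite option \<Rightarrow> real"
  shows "(\<Sum>i\<in>UNIV. f i) = f None + (\<Sum>i\<in>UNIV. f (Some i))"
  by (simp add: UNIV_option_conv sum.reindex)

lemma psd_Some_block:
  fixes B :: "real^('n::finite option)^('n option)"
  assumes "psd B"
  shows "psd (\<chi> i j. B $ Some i $ Some j)"
  unfolding psd_def
proof (intro conjI allI)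
  show "transpose (\<chi> i j. B $ Some i $ Some j) = (\<chi> i j. B $ Some i $ Some j)"
    using psd_sym[OF assms] by (simp add: vec_eq_iff transpose_def)
  fix y :: "real^'n"
  let ?z = "\<chi> i. case i of None \<Rightarrow> 0 | Some j \<Rightarrow> y $ j"
  have "y \<bullet> ((\<chi> i j. B $ Some i $ Some j) *v y) = ?z \<bullet> (B *v ?z)"
    by (simp add: inner_vec_def matrix_vector_mult_def sum_UNIV_option)
  then show "0 \<le> y \<bullet> ((\<chi> i j. B $ Some i $ Some j) *v y)"
    using assms by (simp add: psd_def)
qed

lemma psd_bordered_Schur:
  assumes "psd (bordered x X)"
  shows "psd (X - outer x)"
proof -
  have "(\<chi> i j. deflate (bordered x X) None $ Some i $ Some j) = X - outer x"
    by (simp add: vec_eq_iff deflate_nth bordered_def)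
  then show ?thesis
    using psd_Some_block[OF psd_deflate[OF assms, of None]] by simp
qed

lemma bordered_lower_bound:
  assumes "psd (Q + diag_mat d)" "psd (bordered x X)"
  shows "x \<bullet> (Q *v x) + (\<Sum>i\<in>UNIV. d $ i * ((x $ i)\<^sup>2 - X $ i $ i)) \<le> mat_inner Q X"
proof -
  have "0 \<le> mat_inner (Q + diag_mat d) (X - outer x)"
    by (rule mat_inner_psd_nonneg[OF assms(1) psd_bordered_Schur[OF assms(2)]])
  also have "\<dots> = mat_inner Q X - x \<bullet> (Q *v x)
      - (\<Sum>i\<in>UNIV. d $ i * ((x $ i)\<^sup>2 - X $ i $ i))"
    by (simp add: mat_inner_add_left mat_inner_diag_mat mat_inner_diff_right
        mat_inner_outer[of Q] power2_eq_square right_diff_distrib sum_subtractf)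
  finally show ?thesis by simp
qed

text \<open>Used with \<open>h\<^sub>i = x\<^sub>i\<^sup>2 - X\<^sub>i\<^sub>i\<close>: a negative coefficient calls for an upper bound on \<open>h\<^sub>i\<close>, which
  comes from the convex envelope below \<open>X\<^sub>i\<^sub>i\<close>, and a positive one for a lower bound, which comes
  from the concave envelope above it.\<close>

lemma sum_split_sign:
  fixes d :: "'n::finite \<Rightarrow> real" and f g h :: "'n \<Rightarrow> real"
  assumes "\<And>i. h i \<le> f i" "\<And>i. g i \<le> h i"
  shows "(\<Sum>i | d i < 0. d i * f i) + (\<Sum>i | d i > 0. d i * g i) \<le> (\<Sum>i\<in>UNIV. d i * h i)"
proof -
  have "(\<Sum>i\<in>UNIV. d i * h i) = (\<Sum>i\<in>{i. d i < 0} \<union> {i. d i > 0}. d i * h i)"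
    by (rule sum.mono_neutral_right) auto
  also have "\<dots> = (\<Sum>i | d i < 0. d i * h i) + (\<Sum>i | d i > 0. d i * h i)"
    by (rule sum.union_disjoint) auto
  also have "\<dots> \<ge> (\<Sum>i | d i < 0. d i * f i) + (\<Sum>i | d i > 0. d i * g i)"
    using assms by (intro add_mono sum_mono) (auto intro: mult_left_mono mult_left_mono_neg)
  finally show ?thesis .
qed

theorem theorem1:
  fixes Q :: "real^'n^'n" and q :: "real^'n"
    and S :: "'n \<Rightarrow> real set" and l u :: "'n \<Rightarrow> real \<Rightarrow> real"
    and D :: "(real^'n) set"
  assumes "transpose Q = Q" and "indefinite Q"
    and "\<And>i. S i \<noteq> {}" and "\<And>i. closed (S i)" and "\<And>i. bounded (S i)"
    and "\<And>i. largest_convex_below_square (S i) (l i)"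
    and "\<And>i. smallest_concave_above_square (S i) (u i)"
    and "D \<subseteq> {d. psd (Q + diag_mat d)}"
  shows "mu_BW Q q S l u \<ge> mu_D Q q S l u D"
  unfolding mu_BW_def mu_D_def
proof (rule Inf_superset_mono, clarify)
  fix x X
  assume box: "\<forall>i. lo (S i) \<le> x $ i \<and> x $ i \<le> hi (S i)"
    and env: "\<forall>i. l i (x $ i) \<le> X $ i $ i \<and> X $ i $ i \<le> u i (x $ i)"
    and psd: "psd (bordered x X)"
  have "x \<bullet> (Q *v x) + (\<Sum>i | d $ i < 0. d $ i * ((x $ i)\<^sup>2 - l i (x $ i)))
      + (\<Sum>i | d $ i > 0. d $ i * ((x $ i)\<^sup>2 - u i (x $ i))) \<le> mat_inner Q X"
    if "d \<in> D" for d
  proof -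
    have "psd (Q + diag_mat d)" using assms(8) that by blast
    note bordered_lower_bound[OF this psd]
    moreover have "(\<Sum>i | d $ i < 0. d $ i * ((x $ i)\<^sup>2 - l i (x $ i)))
        + (\<Sum>i | d $ i > 0. d $ i * ((x $ i)\<^sup>2 - u i (x $ i)))
        \<le> (\<Sum>i\<in>UNIV. d $ i * ((x $ i)\<^sup>2 - X $ i $ i))"
      using env by (intro sum_split_sign) simp_all
    ultimately show ?thesis by linarith
  qed
  with box show "\<exists>v x'. ereal (mat_inner Q X + q \<bullet> x) = ereal (v + q \<bullet> x') \<and>
      (\<forall>d\<in>D. x' \<bullet> (Q *v x')
        + (\<Sum>i | d $ i < 0. d $ i * ((x' $ i)\<^sup>2 - l i (x' $ i)))
        + (\<Sum>i | d $ i > 0. d $ i * ((x' $ i)\<^sup>2 - u i (x' $ i))) \<le> v) \<and>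
      (\<forall>i. lo (S i) \<le> x' $ i \<and> x' $ i \<le> hi (S i))"
    by blast
qed

end
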